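(* Let $\mathbb{X}$ be a finite-dimensional Euclidean space, $\varphi:\mathbb{X}\to\mathbb{R}\cup\{\infty\}$ a proper lower semicontinuous convex function, and $(\bar x,\bar v)\in\mathrm{gph}\,\partial\varphi$. For any $w\in\mathbb{X}$ and any $z\in D\partial\varphi(\bar x|\bar v)(w)$ we have $$\langle z,w\rangle=0\ \Longrightarrow\ z\in D\partial\varphi(\bar x|\bar v)(0)\ \text{ and }\ w\in D\partial\varphi^*(\bar v|\bar x)(0).$$ The opposite implication holds (for all such $z,w$) when one of the following conditions is satisfied: (i) $\varphi$ is twice epi-differentiable at $\bar x$ for $\bar v$; (ii) $\varphi$ satisfies the primal-dual quadratic growth condition at $\bar x$ for $\bar v$. Consequently, if $\varphi$ satisfies the primal-dual quadratic growth condition at $\bar x$ for $\bar v$, then for any $z\in D\partial\varphi(\bar x|\bar v)(w)$ we have $$\langle z,w\rangle=0\quad\text{if and only if}\quad z\in T_{\partial\varphi(\bar x)}(\bar v)\ \text{ and }\ w\in T_{\partial\varphi^*(\bar v)}(\bar x).$$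
   Context: $\varphi^*$ is the Fenchel conjugate and $\partial$ the convex subdifferential. Tangent cone: $T_\Omega(\bar u):=\{w\mid\exists\,t_k\downarrow0,\ w_k\to w,\ \bar u+t_kw_k\in\Omega\}$ for $\bar u\in\Omega$. Graphical derivative: for a set-valued mapping $F$ and $(\bar x,\bar y)\in\mathrm{gph}\,F$, $DF(\bar x|\bar y)(w):=\{z\mid(w,z)\in T_{\mathrm{gph}\,F}(\bar x,\bar y)\}$. In particular $D\partial\varphi(\bar x|\bar v)$ is the graphical derivative of $\partial\varphi$ at $\bar x$ for $\bar v$. Second subderivative: $d^2\varphi(\bar x|\bar v)(w):=\liminf_{w'\to w,\ t\downarrow0}\dfrac{\varphi(\bar x+tw')-\varphi(\bar x)-t\langle\bar v,w'\rangle}{\frac12t^2}$. The function $\varphi$ is twice epi-differentiable at $\bar x$ for $\bar v$ if for every $w\in\mathbb{X}$ and every $t_k\downarrow0$ there exists $w_k\to w$ such that $\dfrac{\varphi(\bar x+t_kw_k)-\varphi(\bar x)-t_k\langle\bar v,w_k\rangle}{\frac12t_k^2}\to d^2\varphi(\bar x|\bar v)(w)$. Quadratic growth condition: a proper lower semicontinuous convex function $\varphi$ satisfies it at $\bar x\in\mathrm{dom}\,\varphi$ for $\bar v\in\partial\varphi(\bar x)$ if there exist $c,\varepsilon>0$ such that $\varphi(x)\ge\varphi(\bar x)+\langle\bar v,x-\bar x\rangle+\frac c2[d(x;(\partial\varphi)^{-1}(\bar v))]^2$ for all $x$ with $\|x-\bar x\|<\varepsilon$, where $d(\cdot;\Omega)$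 is the distance to $\Omega$. The function $\varphi$ satisfies the primal-dual quadratic growth condition at $\bar x$ for $\bar v$ if $\varphi$ satisfies the quadratic growth condition at $\bar x$ for $\bar v$ and $\varphi^*$ satisfies the quadratic growth condition at $\bar v$ for $\bar x$. *)

theory Defs
  imports "HOL-Analysis.Analysis"
begin

definition proper_fun :: "('a \<Rightarrow> ereal) \<Rightarrow> bool" where
  "proper_fun f \<longleftrightarrow> (\<forall>x. f x \<noteq> -\<infinity>) \<and> (\<exists>x. f x < \<infinity>)"

definition lsc_fun :: "('a::topological_space \<Rightarrow> ereal) \<Rightarrow> bool" where
  "lsc_fun f \<longleftrightarrow> (\<forall>x. f x \<le> Liminf (at x) f)"

(* Convexity of an extended-real-valued function is convexity of its epigraph in X x R; the
   library's convex_on covers real-valued functions only. *)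
definition convex_fun :: "('a::real_vector \<Rightarrow> ereal) \<Rightarrow> bool" where
  "convex_fun f \<longleftrightarrow> convex {(x, r::real). f x \<le> ereal r}"

(* The dual space is identified with the space itself through the inner product. *)
definition fenchel_conjugate :: "('a::real_inner \<Rightarrow> ereal) \<Rightarrow> 'a \<Rightarrow> ereal" where
  "fenchel_conjugate f v = (SUP x. ereal (v \<bullet> x) - f x)"

(* Empty outside the effective domain. *)
definition subdifferential :: "('a::real_inner \<Rightarrow> ereal) \<Rightarrow> 'a \<Rightarrow> 'a set" where
  "subdifferential f x =
     {v. \<bar>f x\<bar> \<noteq> \<infinity> \<and> (\<forall>y. f x + ereal (v \<bullet> (y - x)) \<le> f y)}"

definition gph :: "('a \<Rightarrow> 'b set) \<Rightarrow> ('a \<times> 'b) set" where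
  "gph F = {(x, y). y \<in> F x}"

(* Only meaningful for u in S. As usual, "t k decreases to 0" stands for positive t k with
   limit 0; monotonicity is not required. *)
definition tangent_cone :: "'a::real_normed_vector set \<Rightarrow> 'a \<Rightarrow> 'a set" where
  "tangent_cone S u =
     {w. \<exists>(t :: nat \<Rightarrow> real) ws. (\<forall>k. 0 < t k) \<and> t \<longlonglongrightarrow> 0 \<and> ws \<longlonglongrightarrow> w \<and>
           (\<forall>k. u + t k *\<^sub>R ws k \<in> S)}"

definition graphical_derivative ::
  "('a::real_normed_vector \<Rightarrow> 'b::real_normed_vector set) \<Rightarrow> 'a \<Rightarrow> 'b \<Rightarrow> 'a \<Rightarrow> 'b set" where
  "graphical_derivative F x y w = {z. (w, z) \<in> tangent_cone (gph F) (x, y)}"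

definition second_quotient ::
  "('a::real_inner \<Rightarrow> ereal) \<Rightarrow> 'a \<Rightarrow> 'a \<Rightarrow> real \<Rightarrow> 'a \<Rightarrow> ereal" where
  "second_quotient f x v t w =
     (f (x + t *\<^sub>R w) - f x - ereal (t * (v \<bullet> w))) / ereal (t\<^sup>2 / 2)"

(* The filter nhds w (rather than at w) lets w' = w take part in the lower limit. *)
definition second_subderivative ::
  "('a::real_inner \<Rightarrow> ereal) \<Rightarrow> 'a \<Rightarrow> 'a \<Rightarrow> 'a \<Rightarrow> ereal" where
  "second_subderivative f x v w =
     Liminf (nhds w \<times>\<^sub>F at_right 0) (\<lambda>(w', t). second_quotient f x v t w')"

(* The convergence is in the extended reals; the limit may be infinite. *)
definition twice_epi_differentiable ::
  "('a::real_inner \<Rightarrow> ereal) \<Rightarrow> 'a \<Rightarrow> 'a \<Rightarrow> bool" where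
  "twice_epi_differentiable f x v \<longleftrightarrow>
     (\<forall>w. \<forall>t :: nat \<Rightarrow> real. (\<forall>k. 0 < t k) \<and> t \<longlonglongrightarrow> 0 \<longrightarrow>
        (\<exists>ws. ws \<longlonglongrightarrow> w \<and>
           (\<lambda>k. second_quotient f x v (t k) (ws k)) \<longlonglongrightarrow> second_subderivative f x v w))"

(* To be used with v in subdifferential f x only: then the set in infdist contains x, and the
   value 0 of infdist on the empty set plays no role. *)
definition quadratic_growth :: "('a::real_inner \<Rightarrow> ereal) \<Rightarrow> 'a \<Rightarrow> 'a \<Rightarrow> bool" where
  "quadratic_growth f x v \<longleftrightarrow>
     (\<exists>c>0. \<exists>\<epsilon>>0. \<forall>y. norm (y - x) < \<epsilon> \<longrightarrow>
        f x + ereal (v \<bullet> (y - x)) + ereal (c / 2 * (infdist y {u. v \<in> subdifferential f u})\<^sup>2)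
          \<le> f y)"

definition primal_dual_quadratic_growth ::
  "('a::real_inner \<Rightarrow> ereal) \<Rightarrow> 'a \<Rightarrow> 'a \<Rightarrow> bool" where
  "primal_dual_quadratic_growth f x v \<longleftrightarrow>
     quadratic_growth f x v \<and> quadratic_growth (fenchel_conjugate f) v x"

end

theory Submission
  imports Defs
begin

text \<open>
  Let \<open>z\<close> belong to the graphical derivative at \<open>w\<close>, as witnessed by pairs
  \<open>(x + t w', v + t z')\<close> in the graph of \<open>\<partial>\<phi>\<close>. Monotonicity of \<open>\<partial>\<phi>\<close> gives \<open>\<langle>z, w\<rangle> \<ge> 0\<close>.

  If \<open>\<langle>z, w\<rangle> = 0\<close>, the subgradient inequalities at the two ends show that \<open>v + t z'\<close> is an
  \<open>\<epsilon>\<close>-subgradient at \<open>x\<close> and \<open>v\<close> is one at \<open>x + t w'\<close>, both with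
  \<open>\<epsilon> = t\<^sup>2 \<langle>z', w'\<rangle> = o(t\<^sup>2)\<close>. An \<open>\<epsilon>\<close>-subgradient lies within a multiple of \<open>sqrt \<epsilon> = o(t)\<close> of an
  exact one, so the mixed directions \<open>(0, z)\<close> and \<open>(w, 0)\<close> are tangent to the graph
  (\<open>graphical_derivative_orthogonal_split\<close>). The approximation comes from the proximal point of
  \<open>\<phi>\<close>, that is, from Minty's theorem on the range of \<open>id + \<partial>\<phi>\<close>. Minty's theorem also shows that
  \<open>\<partial>\<phi>\<^sup>*\<close> is the inverse of \<open>\<partial>\<phi>\<close> (\<open>subdifferential_conjugate_iff\<close>), which turns statements about
  \<open>\<phi>\<^sup>*\<close> into statements about the graph of \<open>\<partial>\<phi>\<close>.

  Conversely, let \<open>(0, z)\<close> and \<open>(w, 0)\<close> be tangent to the graph; it remains to see that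
  \<open>\<langle>z, w\<rangle> \<le> 0\<close>. Under twice epi-differentiability, tangent directions consist of a point and a
  subgradient there of \<open>d\<^sup>2\<phi>/2\<close> (\<open>graphical_derivative_second_subderivative\<close>). As \<open>d\<^sup>2\<phi>\<close> vanishes
  at \<open>0\<close>, the direction \<open>(w, 0)\<close> gives \<open>d\<^sup>2\<phi>(w) \<le> 0\<close> and \<open>(0, z)\<close> gives
  \<open>2 \<langle>z, w\<rangle> \<le> d\<^sup>2\<phi>(w)\<close>. Under primal-dual quadratic growth, the two directions are even tangent to
  the sets \<open>\<partial>\<phi>(x)\<close> and \<open>\<partial>\<phi>\<^sup>*(v)\<close> (\<open>tangent_of_quadratic_growth\<close>), and monotonicity between
  points of these sets gives the sign (\<open>tangents_inner_nonpos\<close>). The last argument starts from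
  the two tangent cones, and so yields the final equivalence as well.
\<close>

section \<open>Subgradients and monotonicity\<close>

lemma subdifferential_finite:
  assumes "v \<in> subdifferential f x"
  obtains a where "f x = ereal a"
  using assms by (cases "f x") (auto simp: subdifferential_def)

lemma subdifferential_le:
  assumes "v \<in> subdifferential f x" and "f x = ereal a"
  shows "ereal (a + v \<bullet> (y - x)) \<le> f y"
  using assms by (auto simp: subdifferential_def)

lemma subdifferentialI:
  assumes "f x = ereal a" and "\<And>y. ereal (a + v \<bullet> (y - x)) \<le> f y"
  shows "v \<in> subdifferential f x"
  using assms by (auto simp: subdifferential_def)

lemma subdifferential_monotone:
  assumes "v \<in> subdifferential f x" and "w \<in> subdifferential f y"
  shows "0 \<le> (v - w) \<bullet> (x - y)"
proof -
  obtain a where a: "f x = ereal a" using assms(1) by (rule subdifferential_finite)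
  obtain b where b: "f y = ereal b" using assms(2) by (rule subdifferential_finite)
  have "a + v \<bullet> (y - x) \<le> b" and "b + w \<bullet> (x - y) \<le> a"
    using subdifferential_le[OF assms(1) a, of y] subdifferential_le[OF assms(2) b, of x] a b
    by auto
  then show ?thesis by (simp add: algebra_simps)
qed

section \<open>The proximal point\<close>

lemma closed_epigraph:
  fixes f :: "'a::euclidean_space \<Rightarrow> ereal"
  assumes "lsc_fun f"
  shows "closed {(y, r::real). f y \<le> ereal r}"
  unfolding closed_sequential_limits
proof (intro allI impI)
  fix s l assume "(\<forall>n. s n \<in> {(y, r). f y \<le> ereal r}) \<and> s \<longlonglongrightarrow> l"
  then have le: "\<And>n. f (fst (s n)) \<le> ereal (snd (s n))" and lim: "s \<longlonglongrightarrow> l"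
    by (auto simp: case_prod_beta)
  have l1: "(\<lambda>n. fst (s n)) \<longlonglongrightarrow> fst l" and l2: "(\<lambda>n. snd (s n)) \<longlonglongrightarrow> snd l"
    using lim by (auto intro: tendsto_fst tendsto_snd)
  have "f (fst l) \<le> ereal (snd l)"
  proof (rule ccontr)
    assume "\<not> ?thesis"
    then have "ereal (snd l) < f (fst l)" by simp
    then obtain c :: ereal where c: "ereal (snd l) < c" "c < f (fst l)" using dense by blast
    have "c < Liminf (at (fst l)) f"
      using c(2) assms unfolding lsc_fun_def by (meson less_le_trans)
    then have "eventually (\<lambda>y. c < f y) (at (fst l))" by (rule less_LiminfD)
    then have "eventually (\<lambda>y. c < f y) (nhds (fst l))"
      using c(2) by (auto simp: eventually_at_filter elim!: eventually_mono)
    then have "eventually (\<lambda>n. c < f (fst (s n))) sequentially"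
      using l1 unfolding filterlim_iff by blast
    moreover have "eventually (\<lambda>n. ereal (snd (s n)) < c) sequentially"
      using order_tendstoD(2)[OF tendsto_ereal[OF l2] c(1)] .
    ultimately have "eventually (\<lambda>n. False) sequentially"
    proof eventually_elim
      case (elim n)
      with le[of n] show ?case by auto
    qed
    then show False by simp
  qed
  then show "l \<in> {(y, r). f y \<le> ereal r}" by (auto simp: case_prod_beta)
qed

text \<open>The quadratic term makes the sublevel sets of \<open>f + 1/2 |\<cdot> - p|\<^sup>2\<close> bounded because \<open>f\<close> has an
  affine minorant. Minimising over the epigraph instead of the space turns the objective into the
  continuous function \<open>r + 1/2 |y - p|\<^sup>2\<close>, so that an extreme value theorem for compact sets
  applies.\<close>

lemma proximal_point_exists:
  fixes f :: "'a::euclidean_space \<Rightarrow> ereal"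
  assumes lsc: "lsc_fun f" and sub: "v \<in> subdifferential f x"
  obtains u b where "f u = ereal b"
    and "\<And>y r. f y \<le> ereal r \<Longrightarrow> b + (norm (u - p))\<^sup>2 / 2 \<le> r + (norm (y - p))\<^sup>2 / 2"
proof -
  obtain a where a: "f x = ereal a" using sub by (rule subdifferential_finite)
  define E where "E = {(y, r::real). f y \<le> ereal r}"
  define g where "g = (\<lambda>q::'a \<times> real. snd q + (norm (fst q - p))\<^sup>2 / 2)"
  have cont: "continuous_on A g" for A
    unfolding g_def by (intro continuous_intros) auto
  have xa: "(x, a) \<in> E" using a by (simp add: E_def)
  define K where "K = E \<inter> {q. g q \<le> g (x, a)}"
  have "closed {q. g q \<le> g (x, a)}"
    by (rule closed_Collect_le) (auto intro: cont)
  then have "closed K"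
    unfolding K_def E_def using closed_epigraph[OF lsc] by auto
  moreover have "bounded K"
  proof -
    define A where "A = a + v \<bullet> (p - x)"
    define R where "R = 2 * norm v + sqrt (4 * (\<bar>g (x, a)\<bar> + \<bar>A\<bar>))"
    have "norm (y - p) \<le> R \<and> \<bar>r\<bar> \<le> \<bar>A\<bar> + norm v * R + \<bar>g (x, a)\<bar>"
      if q: "(y, r) \<in> K" for y r
    proof -
      define n where "n = norm (y - p)"
      have "f y \<le> ereal r" using q by (simp add: K_def E_def)
      with subdifferential_le[OF sub a, of y] have "ereal (a + v \<bullet> (y - x)) \<le> ereal r"
        by (rule order_trans)
      then have "A + v \<bullet> (y - p) \<le> r" by (simp add: A_def algebra_simps)
      moreover have "\<bar>v \<bullet> (y - p)\<bar> \<le> norm v * n"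
        unfolding n_def by (rule Cauchy_Schwarz_ineq2)
      ultimately have lo: "A - norm v * n \<le> r" by linarith
      have hi: "r + n\<^sup>2 / 2 \<le> g (x, a)" using q by (simp add: K_def g_def n_def)
      have "n\<^sup>2 / 2 - norm v * n \<le> \<bar>g (x, a)\<bar> + \<bar>A\<bar>" using lo hi by linarith
      moreover have "(n - 2 * norm v)\<^sup>2 = n\<^sup>2 - 4 * (norm v * n) + 4 * (norm v)\<^sup>2"
        by (simp add: power2_eq_square algebra_simps)
      moreover have nR: "n \<le> R"
      proof (cases "n \<le> 2 * norm v")
        case True
        then show ?thesis by (simp add: R_def add_increasing2)
      next
        case False
        then have "(n - 2 * norm v) * (n - 2 * norm v) \<le> (n - 2 * norm v) * n"
          by (intro mult_left_mono) auto
        then have "(n - 2 * norm v)\<^sup>2 \<le> 4 * (\<bar>g (x, a)\<bar> + \<bar>A\<bar>)"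
          using \<open>n\<^sup>2 / 2 - norm v * n \<le> _\<close> by (simp add: power2_eq_square algebra_simps)
        then have "n - 2 * norm v \<le> sqrt (4 * (\<bar>g (x, a)\<bar> + \<bar>A\<bar>))" by (rule real_le_rsqrt)
        then show ?thesis by (simp add: R_def)
      qed
      have "norm v * n \<le> norm v * R" using nR by (simp add: mult_left_mono)
      then have "\<bar>r\<bar> \<le> \<bar>A\<bar> + norm v * R + \<bar>g (x, a)\<bar>"
        using lo hi zero_le_power2[of n] mult_nonneg_nonneg[OF norm_ge_zero[of v] norm_ge_zero[of "y - p"]]
        unfolding n_def[symmetric] by linarith
      with nR show ?thesis by (simp add: n_def)
    qed
    then have "K \<subseteq> cball p R \<times> cball 0 (\<bar>A\<bar> + norm v * R + \<bar>g (x, a)\<bar>)"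
      by (auto simp: dist_norm norm_minus_commute)
    then show ?thesis by (rule bounded_subset[OF bounded_Times[OF bounded_cball bounded_cball]])
  qed
  ultimately have "compact K" by (simp add: compact_eq_bounded_closed)
  moreover have "(x, a) \<in> K" using xa by (simp add: K_def)
  ultimately obtain m where m: "m \<in> K" "\<And>q. q \<in> K \<Longrightarrow> g m \<le> g q"
    using continuous_attains_inf[OF _ _ cont, of K] by blast
  have min: "g m \<le> g q" if "q \<in> E" for q
    using that m by (cases "g q \<le> g (x, a)") (auto simp: K_def)
  obtain u b where mu: "m = (u, b)" by (cases m)
  have ub: "f u \<le> ereal b" using m(1) mu by (simp add: K_def E_def)
  have "f u \<noteq> -\<infinity>" using subdifferential_le[OF sub a, of u] by auto
  then obtain b' where b': "f u = ereal b'" using ub by (cases "f u") auto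
  \<comment> \<open>a minimiser over the epigraph lies on the graph\<close>
  have "b' = b" using min[of "(u, b')"] ub b' mu by (simp add: E_def g_def)
  then show ?thesis
    using that[of u b] b' min unfolding E_def mu by (auto simp: g_def)
qed

text \<open>Surjectivity of \<open>id + \<partial>f\<close>, which is Minty's criterion for maximal monotonicity of \<open>\<partial>f\<close>: the
  optimality condition of the proximal point is \<open>p - u \<in> \<partial>f(u)\<close>.\<close>

lemma Minty_surjectivity:
  fixes f :: "'a::euclidean_space \<Rightarrow> ereal"
  assumes lsc: "lsc_fun f" and conv: "convex_fun f" and sub: "v \<in> subdifferential f x"
  obtains u where "p - u \<in> subdifferential f u"
proof -
  obtain u b where fu: "f u = ereal b" and
    min: "\<And>y r. f y \<le> ereal r \<Longrightarrow> b + (norm (u - p))\<^sup>2 / 2 \<le> r + (norm (y - p))\<^sup>2 / 2"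
    by (rule proximal_point_exists[OF lsc sub, of p]) blast
  have key: "b + (p - u) \<bullet> (y - u) \<le> r" if y: "f y \<le> ereal r" for y r
  proof -
    define D where "D = r - b - (p - u) \<bullet> (y - u)"
    \<comment> \<open>compare with the points of the segment from \<open>u\<close> to \<open>y\<close> and divide by its parameter\<close>
    have "0 \<le> D + s * ((norm (y - u))\<^sup>2 / 2)" if s: "0 < s" "s < 1" for s
    proof -
      have "(1 - s) *\<^sub>R (u, b) + s *\<^sub>R (y, r) \<in> {(y, r::real). f y \<le> ereal r}"
        using conv s y fu unfolding convex_fun_def by (intro convexD) auto
      then have "f ((1 - s) *\<^sub>R u + s *\<^sub>R y) \<le> ereal ((1 - s) * b + s * r)" by simp
      from min[OF this]
      have "b + (norm (u - p))\<^sup>2 / 2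
          \<le> (1 - s) * b + s * r + (norm ((u - p) + s *\<^sub>R (y - u)))\<^sup>2 / 2"
        by (simp add: algebra_simps)
      moreover have "(norm ((u - p) + s *\<^sub>R (y - u)))\<^sup>2
          = (norm (u - p))\<^sup>2 + 2 * s * ((u - p) \<bullet> (y - u)) + s\<^sup>2 * (norm (y - u))\<^sup>2"
        unfolding power2_norm_eq_inner
        by (simp add: inner_add_left inner_add_right inner_commute power2_eq_square)
      moreover have "(u - p) \<bullet> (y - u) = - ((p - u) \<bullet> (y - u))"
        by (metis inner_minus_left minus_diff_eq)
      ultimately have "0 \<le> s * (D + s * ((norm (y - u))\<^sup>2 / 2))"
        unfolding D_def by (simp add: power2_eq_square algebra_simps)
      with s(1) show ?thesis by (simp add: zero_le_mult_iff)
    qed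
    then have "eventually (\<lambda>s. 0 \<le> D + s * ((norm (y - u))\<^sup>2 / 2)) (at_right 0)"
      unfolding eventually_at_right_field by (intro exI[of _ 1]) auto
    moreover have "((\<lambda>s. D + s * ((norm (y - u))\<^sup>2 / 2)) \<longlongrightarrow> D + 0 * ((norm (y - u))\<^sup>2 / 2)) (at_right 0)"
      by (intro tendsto_intros)
    ultimately have "0 \<le> D + 0 * ((norm (y - u))\<^sup>2 / 2)"
      by (intro tendsto_lowerbound[where F = "at_right 0"]) auto
    then show ?thesis by (simp add: D_def)
  qed
  obtain a where a: "f x = ereal a" using sub by (rule subdifferential_finite)
  have "p - u \<in> subdifferential f u"
  proof (rule subdifferentialI[of _ _ b])
    fix y
    show "ereal (b + (p - u) \<bullet> (y - u)) \<le> f y"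
      using subdifferential_le[OF sub a, of y] key[of y] by (cases "f y") auto
  qed (rule fu)
  then show thesis by (rule that)
qed

text \<open>A quadratic form of the Brondsted-Rockafellar theorem. By Minty, \<open>y0 + v'\<close> splits as
  \<open>u + s\<close> with \<open>s \<in> \<partial>f(u)\<close>; then \<open>e = u - y0\<close> works, because adding the subgradient inequality
  of \<open>s\<close> to the approximate one of \<open>v'\<close> leaves \<open>|e|\<^sup>2 \<le> \<epsilon>\<close>.\<close>

lemma subgradient_near_approximate_subgradient:
  fixes f :: "'a::euclidean_space \<Rightarrow> ereal"
  assumes lsc: "lsc_fun f" and conv: "convex_fun f" and sub: "v \<in> subdifferential f x"
    and fy: "f y0 = ereal a" and approx: "\<And>y. ereal (a + v' \<bullet> (y - y0) - \<epsilon>) \<le> f y"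
  obtains e where "v' - e \<in> subdifferential f (y0 + e)" and "(norm e)\<^sup>2 \<le> \<epsilon>"
proof -
  obtain u where u: "(y0 + v') - u \<in> subdifferential f u"
    by (rule Minty_surjectivity[OF lsc conv sub])
  obtain b where b: "f u = ereal b" using u by (rule subdifferential_finite)
  have "b + (y0 + v' - u) \<bullet> (y0 - u) \<le> a"
    using subdifferential_le[OF u b, of y0] fy by simp
  moreover have "a + v' \<bullet> (u - y0) - \<epsilon> \<le> b" using approx[of u] b by simp
  moreover have "(norm (u - y0))\<^sup>2 = (y0 - u) \<bullet> (y0 - u)"
    by (metis norm_minus_commute power2_norm_eq_inner)
  ultimately have "(norm (u - y0))\<^sup>2 \<le> \<epsilon>"
    by (simp add: algebra_simps)
  then show thesis using that[of "u - y0"] u by (simp add: algebra_simps)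
qed

section \<open>Conjugate duality\<close>

lemma fenchel_conjugate_at_subgradient:
  assumes "v \<in> subdifferential f x" and "f x = ereal a"
  shows "fenchel_conjugate f v = ereal (v \<bullet> x - a)"
  unfolding fenchel_conjugate_def
proof (intro antisym SUP_least SUP_upper2[where i = x])
  fix y
  show "ereal (v \<bullet> y) - f y \<le> ereal (v \<bullet> x - a)"
    using subdifferential_le[OF assms, of y] by (cases "f y") (auto simp: algebra_simps)
qed (use assms(2) in auto)

lemma subdifferential_conjugateI:
  assumes "v \<in> subdifferential f x"
  shows "x \<in> subdifferential (fenchel_conjugate f) v"
proof -
  obtain a where a: "f x = ereal a" using assms by (rule subdifferential_finite)
  show ?thesis
  proof (rule subdifferentialI)
    show "fenchel_conjugate f v = ereal (v \<bullet> x - a)"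
      by (rule fenchel_conjugate_at_subgradient[OF assms a])
    fix y
    have "ereal (y \<bullet> x) - f x \<le> fenchel_conjugate f y"
      unfolding fenchel_conjugate_def by (rule SUP_upper) simp
    then show "ereal (v \<bullet> x - a + x \<bullet> (y - v)) \<le> fenchel_conjugate f y"
      using a by (simp add: algebra_simps inner_commute)
  qed
qed

text \<open>The nontrivial direction says that \<open>\<partial>f\<^sup>*\<close> is not larger than the inverse of \<open>\<partial>f\<close>. The
  reason is that \<open>\<partial>f\<^sup>*\<close> is monotone, while the inverse of \<open>\<partial>f\<close>, which it contains, is already a
  maximal monotone relation by Minty's criterion.\<close>

lemma subdifferential_conjugate_iff:
  fixes f :: "'a::euclidean_space \<Rightarrow> ereal"
  assumes "lsc_fun f" and "convex_fun f" and "v0 \<in> subdifferential f x0"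
  shows "x \<in> subdifferential (fenchel_conjugate f) v \<longleftrightarrow> v \<in> subdifferential f x"
proof
  assume x: "x \<in> subdifferential (fenchel_conjugate f) v"
  obtain u where u: "(x + v) - u \<in> subdifferential f u"
    by (rule Minty_surjectivity[OF assms])
  have "0 \<le> (x - u) \<bullet> (v - (x + v - u))"
    by (rule subdifferential_monotone[OF x subdifferential_conjugateI[OF u]])
  then have "(x - u) \<bullet> (x - u) \<le> 0" by (simp add: algebra_simps)
  then have "x = u" using inner_gt_zero_iff[of "x - u"] by (smt (verit) right_minus_eq)
  with u show "v \<in> subdifferential f x" by simp
qed (rule subdifferential_conjugateI)

section \<open>Graphical derivatives\<close>

lemma graphical_derivative_iff:
  "z \<in> graphical_derivative F x y w \<longleftrightarrow>
    (\<exists>t ws zs. (\<forall>k::nat. 0 < t k) \<and> t \<longlonglongrightarrow> 0 \<and> ws \<longlonglongrightarrow> w \<and> zs \<longlonglongrightarrow> z \<and>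
      (\<forall>k. y + t k *\<^sub>R zs k \<in> F (x + t k *\<^sub>R ws k)))" (is "?L \<longleftrightarrow> ?R")
proof
  assume ?L
  then obtain t ps where t: "\<forall>k::nat. 0 < t k" "t \<longlonglongrightarrow> 0" "ps \<longlonglongrightarrow> (w, z)"
    "\<forall>k. (x, y) + t k *\<^sub>R ps k \<in> gph F"
    by (auto simp: graphical_derivative_def tangent_cone_def)
  then have "(\<lambda>k. fst (ps k)) \<longlonglongrightarrow> w" "(\<lambda>k. snd (ps k)) \<longlonglongrightarrow> z"
    using tendsto_fst tendsto_snd by fastforce+
  moreover have "\<forall>k. y + t k *\<^sub>R snd (ps k) \<in> F (x + t k *\<^sub>R fst (ps k))"
    using t(4) by (auto simp: gph_def case_prod_beta)
  ultimately show ?R using t(1,2) by (intro exI[of _ t] exI conjI) auto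
next
  assume ?R
  then obtain t ws zs where "\<forall>k::nat. 0 < t k" "t \<longlonglongrightarrow> 0" "ws \<longlonglongrightarrow> w" "zs \<longlonglongrightarrow> z"
    "\<forall>k. y + t k *\<^sub>R zs k \<in> F (x + t k *\<^sub>R ws k)" by blast
  then show ?L
    unfolding graphical_derivative_def tangent_cone_def
    by (auto simp: gph_def intro!: exI[of _ t] exI[of _ "\<lambda>k. (ws k, zs k)"] tendsto_Pair)
qed

lemma graphical_derivative_conjugate:
  fixes f :: "'a::euclidean_space \<Rightarrow> ereal"
  assumes "lsc_fun f" and "convex_fun f" and "v \<in> subdifferential f x"
  shows "w \<in> graphical_derivative (subdifferential (fenchel_conjugate f)) v x z \<longleftrightarrow>
    z \<in> graphical_derivative (subdifferential f) x v w"
  unfolding graphical_derivative_iff subdifferential_conjugate_iff[OF assms] by blast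

lemma graphical_derivative_inner_nonneg:
  assumes "v \<in> subdifferential f x" and "z \<in> graphical_derivative (subdifferential f) x v w"
  shows "0 \<le> z \<bullet> w"
proof -
  obtain t ws zs where t: "\<forall>k::nat. 0 < t k" and lim: "ws \<longlonglongrightarrow> w" "zs \<longlonglongrightarrow> z"
    and sub: "\<forall>k. v + t k *\<^sub>R zs k \<in> subdifferential f (x + t k *\<^sub>R ws k)"
    using assms(2) unfolding graphical_derivative_iff by blast
  have "0 \<le> zs k \<bullet> ws k" for k
  proof -
    have "0 \<le> (t k * t k) * (zs k \<bullet> ws k)"
      using subdifferential_monotone[OF sub[rule_format, of k] assms(1)] by (simp add: mult.assoc)
    moreover have "0 < t k * t k" using t by simp
    ultimately show ?thesis by (simp only: zero_le_mult_iff) linarith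
  qed
  then show ?thesis
    using tendsto_lowerbound[OF tendsto_inner[OF lim(2,1)], of 0] by simp
qed

text \<open>Each of the two subgradients fails at the base point of the other by a controlled error:
  \<open>v + t z\<close> is a \<open>t\<^sup>2 \<langle>z, w\<rangle>\<close>-subgradient at \<open>x\<close>, and so is \<open>v\<close> at \<open>x + t w\<close>. Hence each
  of the two mixed pairs is within a multiple of \<open>t sqrt \<langle>z, w\<rangle>\<close> of the graph, which is \<open>o(t)\<close>
  along sequences with \<open>\<langle>z, w\<rangle> \<rightarrow> 0\<close>.\<close>

lemma mixed_pairs_near_graph:
  fixes f :: "'a::euclidean_space \<Rightarrow> ereal"
  assumes lsc: "lsc_fun f" and conv: "convex_fun f" and sub: "v \<in> subdifferential f x"
    and t: "0 < t" and sub': "v + t *\<^sub>R z \<in> subdifferential f (x + t *\<^sub>R w)"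
  shows "\<exists>e. (norm e)\<^sup>2 \<le> z \<bullet> w \<and> v + t *\<^sub>R (z - e) \<in> subdifferential f (x + t *\<^sub>R e)"
    and "\<exists>e. (norm e)\<^sup>2 \<le> z \<bullet> w \<and> v + t *\<^sub>R (- e) \<in> subdifferential f (x + t *\<^sub>R (w + e))"
proof -
  obtain a where a: "f x = ereal a" using sub by (rule subdifferential_finite)
  obtain b where b: "f (x + t *\<^sub>R w) = ereal b" using sub' by (rule subdifferential_finite)
  have ab: "a + t * (v \<bullet> w) \<le> b" and ba: "b - t * (v \<bullet> w) - t\<^sup>2 * (z \<bullet> w) \<le> a"
    using subdifferential_le[OF sub a, of "x + t *\<^sub>R w"] subdifferential_le[OF sub' b, of x] a b
    by (auto simp: inner_add_left power2_eq_square algebra_simps)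
  have scale: "(norm ((1 / t) *\<^sub>R e))\<^sup>2 \<le> z \<bullet> w" if "(norm e)\<^sup>2 \<le> t\<^sup>2 * (z \<bullet> w)" for e :: 'a
    using that t by (simp add: power_mult_distrib power_divide divide_simps mult.commute)

  have 1: "ereal (a + (v + t *\<^sub>R z) \<bullet> (y - x) - t\<^sup>2 * (z \<bullet> w)) \<le> f y" for y
  proof (rule order_trans[OF _ subdifferential_le[OF sub' b]])
    show "ereal (a + (v + t *\<^sub>R z) \<bullet> (y - x) - t\<^sup>2 * (z \<bullet> w))
      \<le> ereal (b + (v + t *\<^sub>R z) \<bullet> (y - (x + t *\<^sub>R w)))"
      using ab by (simp add: inner_add_left power2_eq_square algebra_simps)
  qed
  obtain e where "v + t *\<^sub>R z - e \<in> subdifferential f (x + e)" "(norm e)\<^sup>2 \<le> t\<^sup>2 * (z \<bullet> w)"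
    by (rule subgradient_near_approximate_subgradient[OF lsc conv sub a 1])
  then show "\<exists>e. (norm e)\<^sup>2 \<le> z \<bullet> w \<and> v + t *\<^sub>R (z - e) \<in> subdifferential f (x + t *\<^sub>R e)"
    using scale t by (intro exI[of _ "(1 / t) *\<^sub>R e"]) (simp add: algebra_simps)

  have 2: "ereal (b + v \<bullet> (y - (x + t *\<^sub>R w)) - t\<^sup>2 * (z \<bullet> w)) \<le> f y" for y
  proof (rule order_trans[OF _ subdifferential_le[OF sub a]])
    show "ereal (b + v \<bullet> (y - (x + t *\<^sub>R w)) - t\<^sup>2 * (z \<bullet> w)) \<le> ereal (a + v \<bullet> (y - x))"
      using ba by (simp add: algebra_simps)
  qed
  obtain e where "v - e \<in> subdifferential f (x + t *\<^sub>R w + e)" "(norm e)\<^sup>2 \<le> t\<^sup>2 * (z \<bullet> w)"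
    by (rule subgradient_near_approximate_subgradient[OF lsc conv sub b 2])
  then show "\<exists>e. (norm e)\<^sup>2 \<le> z \<bullet> w \<and> v + t *\<^sub>R (- e) \<in> subdifferential f (x + t *\<^sub>R (w + e))"
    using scale t by (intro exI[of _ "(1 / t) *\<^sub>R e"]) (simp add: algebra_simps)
qed

lemma tendsto_zero_of_norm_square_le:
  fixes e :: "nat \<Rightarrow> 'a::real_normed_vector"
  assumes "\<And>k. (norm (e k))\<^sup>2 \<le> s k" and "s \<longlonglongrightarrow> 0"
  shows "e \<longlonglongrightarrow> 0"
proof (rule Lim_null_comparison)
  show "eventually (\<lambda>k. norm (e k) \<le> sqrt (s k)) sequentially"
    using assms(1) by (simp add: real_le_rsqrt)
  show "(\<lambda>k. sqrt (s k)) \<longlonglongrightarrow> 0" using tendsto_real_sqrt[OF assms(2)] by simp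
qed

lemma graphical_derivative_orthogonal_split:
  fixes f :: "'a::euclidean_space \<Rightarrow> ereal"
  assumes lsc: "lsc_fun f" and conv: "convex_fun f" and sub: "v \<in> subdifferential f x"
    and z: "z \<in> graphical_derivative (subdifferential f) x v w" and orth: "z \<bullet> w = 0"
  shows "z \<in> graphical_derivative (subdifferential f) x v 0"
    and "0 \<in> graphical_derivative (subdifferential f) x v w"
proof -
  obtain t ws zs where t: "\<And>k::nat. 0 < t k" "t \<longlonglongrightarrow> 0" and lim: "ws \<longlonglongrightarrow> w" "zs \<longlonglongrightarrow> z"
    and sub': "\<And>k. v + t k *\<^sub>R zs k \<in> subdifferential f (x + t k *\<^sub>R ws k)"
    using z unfolding graphical_derivative_iff by blast
  have s: "(\<lambda>k. zs k \<bullet> ws k) \<longlonglongrightarrow> 0"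
    using tendsto_inner[OF lim(2,1)] orth by simp
  note mixed = mixed_pairs_near_graph[OF lsc conv sub t(1) sub']
  obtain d where d: "\<And>k. (norm (d k))\<^sup>2 \<le> zs k \<bullet> ws k"
    "\<And>k. v + t k *\<^sub>R (zs k - d k) \<in> subdifferential f (x + t k *\<^sub>R d k)"
    using mixed(1) by metis
  have d0: "d \<longlonglongrightarrow> 0" by (rule tendsto_zero_of_norm_square_le[OF d(1) s])
  have "(\<lambda>k. zs k - d k) \<longlonglongrightarrow> z" using tendsto_diff[OF lim(2) d0] by simp
  then show "z \<in> graphical_derivative (subdifferential f) x v 0"
    unfolding graphical_derivative_iff using t d0 d(2) by blast
  obtain e where e: "\<And>k. (norm (e k))\<^sup>2 \<le> zs k \<bullet> ws k"
    "\<And>k. v + t k *\<^sub>R (- e k) \<in> subdifferential f (x + t k *\<^sub>R (ws k + e k))"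
    using mixed(2) by metis
  have e0: "e \<longlonglongrightarrow> 0" by (rule tendsto_zero_of_norm_square_le[OF e(1) s])
  have "(\<lambda>k. ws k + e k) \<longlonglongrightarrow> w" and "(\<lambda>k. - e k) \<longlonglongrightarrow> 0"
    using tendsto_add[OF lim(1) e0] tendsto_minus[OF e0] by simp_all
  then show "0 \<in> graphical_derivative (subdifferential f) x v w"
    unfolding graphical_derivative_iff using t e(2)
    by (intro exI[of _ t] exI[of _ "\<lambda>k. ws k + e k"] exI[of _ "\<lambda>k. - e k"]) simp
qed

section \<open>Twice epi-differentiability\<close>

lemma second_quotient_subgradient:
  assumes sub: "v \<in> subdifferential f x" and t: "0 < t"
    and sub': "v + t *\<^sub>R z \<in> subdifferential f (x + t *\<^sub>R w)"
  shows "second_quotient f x v t w + ereal (2 * (z \<bullet> (u - w))) \<le> second_quotient f x v t u"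
proof -
  obtain a where a: "f x = ereal a" using sub by (rule subdifferential_finite)
  obtain b where b: "f (x + t *\<^sub>R w) = ereal b" using sub' by (rule subdifferential_finite)
  have le: "ereal (b + (v + t *\<^sub>R z) \<bullet> (x + t *\<^sub>R u - (x + t *\<^sub>R w))) \<le> f (x + t *\<^sub>R u)"
    by (rule subdifferential_le[OF sub' b])
  show ?thesis
  proof (cases "f (x + t *\<^sub>R u)")
    case (real c)
    have "b + t * (v \<bullet> u) - t * (v \<bullet> w) + t\<^sup>2 * (z \<bullet> (u - w)) \<le> c"
      using le real by (simp add: inner_add_left power2_eq_square algebra_simps)
    then have "((b - a - t * (v \<bullet> w)) + t\<^sup>2 * (z \<bullet> (u - w))) / (t\<^sup>2 / 2)
        \<le> (c - a - t * (v \<bullet> u)) / (t\<^sup>2 / 2)"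
      by (intro divide_right_mono) auto
    then have "(b - a - t * (v \<bullet> w)) / (t\<^sup>2 / 2) + 2 * (z \<bullet> (u - w))
        \<le> (c - a - t * (v \<bullet> u)) / (t\<^sup>2 / 2)"
      using t by (simp add: add_divide_distrib)
    then show ?thesis using t by (simp add: second_quotient_def a b real)
  next
    case PInf
    then show ?thesis using t by (simp add: second_quotient_def a b)
  next
    case MInf
    then show ?thesis using le by simp
  qed
qed

lemma second_quotient_zero:
  assumes "v \<in> subdifferential f x"
  shows "second_quotient f x v t 0 = 0"
proof -
  obtain a where "f x = ereal a" using assms by (rule subdifferential_finite)
  then show ?thesis by (simp add: second_quotient_def)
qed

lemma second_subderivative_le_Liminf:
  assumes "\<And>k::nat. 0 < t k" and "t \<longlonglongrightarrow> 0" and "ws \<longlonglongrightarrow> w"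
  shows "second_subderivative f x v w \<le> Liminf sequentially (\<lambda>k. second_quotient f x v (t k) (ws k))"
proof -
  have "filterlim t (at_right 0) sequentially"
    using assms(1,2) by (auto simp: filterlim_at intro!: always_eventually simp: less_imp_neq[symmetric])
  then have lim: "filterlim (\<lambda>k. (ws k, t k)) (nhds w \<times>\<^sub>F at_right 0) sequentially"
    using assms(3) by (intro filterlim_Pair)
  show ?thesis
    unfolding le_Liminf_iff
  proof (intro allI impI)
    fix c assume "c < second_subderivative f x v w"
    then have "eventually (\<lambda>p. c < (case p of (w', t) \<Rightarrow> second_quotient f x v t w'))
        (nhds w \<times>\<^sub>F at_right 0)"
      unfolding second_subderivative_def by (rule less_LiminfD)
    from eventually_compose_filterlim[OF this lim]
    show "eventually (\<lambda>k. c < second_quotient f x v (t k) (ws k)) sequentially" by simp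
  qed
qed

lemma second_subderivative_nonneg:
  assumes "v \<in> subdifferential f x"
  shows "0 \<le> second_subderivative f x v w"
  unfolding second_subderivative_def
proof (rule Liminf_bounded)
  have "0 \<le> second_quotient f x v t u" if "0 < t" for t u
    using second_quotient_subgradient[of v f x t 0 0 u] assms that second_quotient_zero[OF assms]
    by simp
  moreover have "eventually (\<lambda>p. 0 < snd p) (nhds w \<times>\<^sub>F at_right (0::real))"
    unfolding eventually_prod_filter
    by (intro exI[of _ "\<lambda>_. True"] exI[of _ "\<lambda>t. 0 < t"]) (auto simp: eventually_at_filter)
  ultimately show "eventually (\<lambda>p. 0 \<le> (case p of (w', t) \<Rightarrow> second_quotient f x v t w'))
      (nhds w \<times>\<^sub>F at_right 0)"
    by (auto elim!: eventually_mono)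
qed

lemma second_subderivative_zero:
  assumes "v \<in> subdifferential f x"
  shows "second_subderivative f x v 0 = 0"
proof (rule antisym)
  have "second_subderivative f x v 0
      \<le> Liminf sequentially (\<lambda>k. second_quotient f x v (inverse (real (Suc k))) 0)"
    using LIMSEQ_inverse_real_of_nat by (intro second_subderivative_le_Liminf) auto
  then show "second_subderivative f x v 0 \<le> 0"
    by (simp add: second_quotient_zero[OF assms] Liminf_const)
qed (rule second_subderivative_nonneg[OF assms])

text \<open>The part of proto-differentiability that is needed: an element of the graphical derivative is
  a subgradient of \<open>d\<^sup>2f/2\<close>. At the base point the lower limit defining \<open>d\<^sup>2f\<close> bounds the
  quotients from below along any sequence; at the test point \<open>u\<close>, twice epi-differentiability
  supplies a recovery sequence for the very same parameters \<open>t\<^sub>k\<close>.\<close>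

lemma graphical_derivative_second_subderivative:
  assumes epi: "twice_epi_differentiable f x v" and sub: "v \<in> subdifferential f x"
    and z: "z \<in> graphical_derivative (subdifferential f) x v w"
  shows "second_subderivative f x v w + ereal (2 * (z \<bullet> (u - w))) \<le> second_subderivative f x v u"
proof -
  obtain t ws zs where t: "\<And>k::nat. 0 < t k" "t \<longlonglongrightarrow> 0" and lim: "ws \<longlonglongrightarrow> w" "zs \<longlonglongrightarrow> z"
    and sub': "\<And>k. v + t k *\<^sub>R zs k \<in> subdifferential f (x + t k *\<^sub>R ws k)"
    using z unfolding graphical_derivative_iff by blast
  obtain us where us: "us \<longlonglongrightarrow> u"
    "(\<lambda>k. second_quotient f x v (t k) (us k)) \<longlonglongrightarrow> second_subderivative f x v u"
    using epi t unfolding twice_epi_differentiable_def by blast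
  define q where "q = (\<lambda>k. second_quotient f x v (t k) (ws k))"
  define l where "l = (\<lambda>k. ereal (2 * (zs k \<bullet> (us k - ws k))))"
  have l: "l \<longlonglongrightarrow> ereal (2 * (z \<bullet> (u - w)))"
    unfolding l_def by (intro tendsto_intros lim us)
  have "second_subderivative f x v w + ereal (2 * (z \<bullet> (u - w)))
      \<le> Liminf sequentially q + ereal (2 * (z \<bullet> (u - w)))"
    unfolding q_def by (intro add_right_mono second_subderivative_le_Liminf t lim)
  also have "\<dots> = Liminf sequentially (\<lambda>k. l k + q k)"
    using ereal_liminf_lim_add[OF l, of q] by (simp add: add.commute)
  also have "\<dots> \<le> Liminf sequentially (\<lambda>k. second_quotient f x v (t k) (us k))"
    using second_quotient_subgradient[OF sub t(1) sub'] unfolding q_def l_def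
    by (intro Liminf_mono) (simp add: add.commute)
  also have "\<dots> = second_subderivative f x v u"
    using us(2) by (intro lim_imp_Liminf) auto
  finally show ?thesis .
qed

lemma orthogonal_if_twice_epi_differentiable:
  assumes epi: "twice_epi_differentiable f x v" and sub: "v \<in> subdifferential f x"
    and z: "z \<in> graphical_derivative (subdifferential f) x v w"
    and z0: "z \<in> graphical_derivative (subdifferential f) x v 0"
    and w0: "0 \<in> graphical_derivative (subdifferential f) x v w"
  shows "z \<bullet> w = 0"
proof -
  note le = graphical_derivative_second_subderivative[OF epi sub]
  have "second_subderivative f x v w \<le> 0"
    using le[OF w0, of 0] second_subderivative_zero[OF sub] by simp
  moreover have "ereal (2 * (z \<bullet> w)) \<le> second_subderivative f x v w"
    using le[OF z0, of w] second_subderivative_zero[OF sub] by simp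
  ultimately have "ereal (2 * (z \<bullet> w)) \<le> 0" by (rule order_trans[rotated])
  then have "z \<bullet> w \<le> 0" by simp
  with graphical_derivative_inner_nonneg[OF sub z] show ?thesis by simp
qed

section \<open>Quadratic growth\<close>

text \<open>If \<open>v + t z' \<in> \<partial>f(x + t w')\<close>, then \<open>f\<close> exceeds its affine minorant with slope \<open>v\<close> at
  \<open>x + t w'\<close> by at most \<open>t\<^sup>2 \<langle>z', w'\<rangle>\<close>, which is \<open>o(t\<^sup>2)\<close> when \<open>z' \<rightarrow> 0\<close>. Quadratic growth then
  puts \<open>x + t w'\<close> within \<open>o(t)\<close> of the inverse image of \<open>v\<close> under \<open>\<partial>f\<close>. The lemma serves twice:
  for a function and, with \<open>x\<close> and \<open>v\<close> exchanged, for its conjugate.\<close>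

lemma tangent_of_quadratic_growth:
  assumes growth: "quadratic_growth f x v" and sub: "v \<in> subdifferential f x"
    and w: "0 \<in> graphical_derivative (subdifferential f) x v w"
  shows "w \<in> tangent_cone {u. v \<in> subdifferential f u} x"
proof -
  define S where "S = {u. v \<in> subdifferential f u}"
  have xS: "x \<in> S" using sub by (simp add: S_def)
  obtain c \<epsilon> where c: "c > 0" "\<epsilon> > 0" and g: "\<And>y. norm (y - x) < \<epsilon> \<Longrightarrow>
        f x + ereal (v \<bullet> (y - x)) + ereal (c / 2 * (infdist y S)\<^sup>2) \<le> f y"
    using growth unfolding quadratic_growth_def S_def by blast
  obtain t ws zs where t: "\<And>k::nat. 0 < t k" "t \<longlonglongrightarrow> 0" and lim: "ws \<longlonglongrightarrow> w" "zs \<longlonglongrightarrow> 0"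
    and sub': "\<And>k. v + t k *\<^sub>R zs k \<in> subdifferential f (x + t k *\<^sub>R ws k)"
    using w unfolding graphical_derivative_iff by blast
  obtain a where a: "f x = ereal a" using sub by (rule subdifferential_finite)
  \<comment> \<open>nearest points need not exist here, so allow an excess of order \<open>t\<^sup>2\<close>\<close>
  have "\<exists>p\<in>S. dist (x + t k *\<^sub>R ws k) p < infdist (x + t k *\<^sub>R ws k) S + (t k)\<^sup>2" for k
  proof -
    have "(INF p\<in>S. dist (x + t k *\<^sub>R ws k) p) < infdist (x + t k *\<^sub>R ws k) S + (t k)\<^sup>2"
      using t(1)[of k] xS by (auto simp: infdist_def)
    then show ?thesis
      by (subst (asm) cINF_less_iff) (use xS in auto)
  qed
  then obtain p where p: "\<And>k. p k \<in> S"
    "\<And>k. dist (x + t k *\<^sub>R ws k) (p k) < infdist (x + t k *\<^sub>R ws k) S + (t k)\<^sup>2"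
    by metis
  define us where "us = (\<lambda>k. (1 / t k) *\<^sub>R (p k - x))"
  have us: "x + t k *\<^sub>R us k = p k" for k using t(1)[of k] by (simp add: us_def)
  have bound: "norm (us k - ws k) \<le> sqrt (2 / c * (zs k \<bullet> ws k)) + t k"
    if near: "norm (t k *\<^sub>R ws k) < \<epsilon>" for k
  proof -
    define d where "d = infdist (x + t k *\<^sub>R ws k) S"
    obtain b where b: "f (x + t k *\<^sub>R ws k) = ereal b"
      using sub'[of k] by (rule subdifferential_finite)
    have "a + t k * (v \<bullet> ws k) + c / 2 * d\<^sup>2 \<le> b"
      using g[of "x + t k *\<^sub>R ws k"] near a b by (simp add: d_def)
    moreover have "b - t k * (v \<bullet> ws k) - (t k)\<^sup>2 * (zs k \<bullet> ws k) \<le> a"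
      using subdifferential_le[OF sub'[of k] b, of x] a
      by (simp add: inner_add_left power2_eq_square algebra_simps)
    ultimately have "c / 2 * d\<^sup>2 \<le> (t k)\<^sup>2 * (zs k \<bullet> ws k)" by simp
    then have "(d / t k)\<^sup>2 \<le> 2 / c * (zs k \<bullet> ws k)"
      using c t(1)[of k] by (simp add: power_divide field_simps)
    then have "d / t k \<le> sqrt (2 / c * (zs k \<bullet> ws k))" by (rule real_le_rsqrt)
    moreover have "t k * norm (us k - ws k) = dist (x + t k *\<^sub>R ws k) (p k)"
    proof -
      have "dist (x + t k *\<^sub>R ws k) (p k) = norm (t k *\<^sub>R (us k - ws k))"
        unfolding us[of k, symmetric] dist_norm
        by (simp add: norm_minus_commute scaleR_diff_right)
      then show ?thesis using t(1)[of k] by simp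
    qed
    then have "t k * norm (us k - ws k) \<le> t k * (d / t k + t k)"
      using p(2)[of k] t(1)[of k] by (simp add: d_def power2_eq_square algebra_simps)
    then have "norm (us k - ws k) \<le> d / t k + t k" using t(1)[of k] by simp
    ultimately show ?thesis by linarith
  qed
  have "(\<lambda>k. norm (t k *\<^sub>R ws k)) \<longlonglongrightarrow> norm (0 *\<^sub>R w)"
    by (intro tendsto_intros t lim)
  then have "eventually (\<lambda>k. norm (t k *\<^sub>R ws k) < \<epsilon>) sequentially"
    using c(2) by (intro order_tendstoD(2)) auto
  then have "eventually (\<lambda>k. norm (us k - ws k) \<le> sqrt (2 / c * (zs k \<bullet> ws k)) + t k) sequentially"
    by eventually_elim (rule bound)
  moreover have "(\<lambda>k. sqrt (2 / c * (zs k \<bullet> ws k)) + t k) \<longlonglongrightarrow> sqrt (2 / c * (0 \<bullet> w)) + 0"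
    by (intro tendsto_intros t lim)
  then have "(\<lambda>k. sqrt (2 / c * (zs k \<bullet> ws k)) + t k) \<longlonglongrightarrow> 0" by simp
  ultimately have "(\<lambda>k. us k - ws k) \<longlonglongrightarrow> 0" by (rule Lim_null_comparison)
  from tendsto_add[OF this lim(1)] have "us \<longlonglongrightarrow> w" by simp
  with t p(1) show ?thesis
    unfolding tangent_cone_def S_def[symmetric] by (auto simp: us intro!: exI[of _ t] exI[of _ us])
qed

text \<open>Monotonicity pairs points \<open>v + s z'\<close> of \<open>\<partial>f(x)\<close> with points \<open>x + t w'\<close> at which \<open>v\<close> is a
  subgradient, giving \<open>- s t \<langle>z', w'\<rangle> \<ge> 0\<close>.\<close>

lemma tangents_inner_nonpos:
  assumes z: "z \<in> tangent_cone (subdifferential f x) v"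
    and w: "w \<in> tangent_cone {u. v \<in> subdifferential f u} x"
  shows "z \<bullet> w \<le> 0"
proof -
  obtain s zs where s: "\<And>k::nat. 0 < s k" "zs \<longlonglongrightarrow> z"
    "\<And>k. v + s k *\<^sub>R zs k \<in> subdifferential f x"
    using z unfolding tangent_cone_def by blast
  obtain t ws where t: "\<And>k::nat. 0 < t k" "ws \<longlonglongrightarrow> w"
    "\<And>k. v \<in> subdifferential f (x + t k *\<^sub>R ws k)"
    using w unfolding tangent_cone_def by blast
  have "zs k \<bullet> ws k \<le> 0" for k
  proof -
    have "(s k * t k) * (zs k \<bullet> ws k) \<le> 0"
      using subdifferential_monotone[OF s(3)[of k] t(3)[of k]] by (simp add: algebra_simps)
    moreover have "0 < s k * t k" using s(1)[of k] t(1)[of k] by simp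
    ultimately show ?thesis by (metis mult_pos_pos not_le)
  qed
  then show ?thesis
    using tendsto_upperbound[OF tendsto_inner[OF s(2) t(2)], of 0] by simp
qed

section \<open>Characterization of orthogonality\<close>

theorem theorem3p6:
  fixes \<phi> :: "'a::euclidean_space \<Rightarrow> ereal" and x v :: 'a
  assumes "proper_fun \<phi>" and "lsc_fun \<phi>" and "convex_fun \<phi>"
    and "(x, v) \<in> gph (subdifferential \<phi>)"
  shows
    "(\<forall>w. \<forall>z \<in> graphical_derivative (subdifferential \<phi>) x v w.
        z \<bullet> w = 0 \<longrightarrow>
          z \<in> graphical_derivative (subdifferential \<phi>) x v 0 \<and>
          w \<in> graphical_derivative (subdifferential (fenchel_conjugate \<phi>)) v x 0) \<and>
     (twice_epi_differentiable \<phi> x v \<or> primal_dual_quadratic_growth \<phi> x v \<longrightarrow>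
      (\<forall>w. \<forall>z \<in> graphical_derivative (subdifferential \<phi>) x v w.
        z \<in> graphical_derivative (subdifferential \<phi>) x v 0 \<and>
        w \<in> graphical_derivative (subdifferential (fenchel_conjugate \<phi>)) v x 0 \<longrightarrow>
          z \<bullet> w = 0)) \<and>
     (primal_dual_quadratic_growth \<phi> x v \<longrightarrow>
      (\<forall>w. \<forall>z \<in> graphical_derivative (subdifferential \<phi>) x v w.
        z \<bullet> w = 0 \<longleftrightarrow>
          z \<in> tangent_cone (subdifferential \<phi> x) v \<and>
          w \<in> tangent_cone (subdifferential (fenchel_conjugate \<phi>) v) x))"
proof -
  let ?D = "graphical_derivative (subdifferential \<phi>) x v"
  let ?D' = "graphical_derivative (subdifferential (fenchel_conjugate \<phi>)) v x"
  let ?Tz = "tangent_cone (subdifferential \<phi> x) v"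
  let ?Tw = "tangent_cone (subdifferential (fenchel_conjugate \<phi>) v) x"
  have sub: "v \<in> subdifferential \<phi> x" using assms(4) by (simp add: gph_def)
  note reg = assms(2,3) sub
  note dual = graphical_derivative_conjugate[OF reg]
  have inv: "subdifferential (fenchel_conjugate \<phi>) v = {u. v \<in> subdifferential \<phi> u}"
    and inv': "{u. x \<in> subdifferential (fenchel_conjugate \<phi>) u} = subdifferential \<phi> x"
    using subdifferential_conjugate_iff[OF reg] by auto
  have split: "z \<in> ?D 0 \<and> w \<in> ?D' 0" if "z \<in> ?D w" "z \<bullet> w = 0" for z w
    using graphical_derivative_orthogonal_split[OF reg that] by (simp add: dual)
  have tangents: "z \<in> ?Tz \<and> w \<in> ?Tw"
    if "primal_dual_quadratic_growth \<phi> x v" "z \<in> ?D 0" "w \<in> ?D' 0" for z w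
  proof
    have growth: "quadratic_growth \<phi> x v" "quadratic_growth (fenchel_conjugate \<phi>) v x"
      using that(1) by (auto simp: primal_dual_quadratic_growth_def)
    show "w \<in> ?Tw"
      using tangent_of_quadratic_growth[OF growth(1) sub] that(3) by (simp add: inv dual)
    show "z \<in> ?Tz"
      using tangent_of_quadratic_growth[OF growth(2) subdifferential_conjugateI[OF sub]] that(2)
      by (simp add: inv' dual)
  qed
  have orth: "z \<bullet> w = 0" if "z \<in> ?D w" "z \<in> ?Tz" "w \<in> ?Tw" for z w
    using tangents_inner_nonpos[of z \<phi> x v w] graphical_derivative_inner_nonneg[OF sub that(1)]
      that(2,3) by (simp add: inv)
  have epi: "z \<bullet> w = 0"
    if "twice_epi_differentiable \<phi> x v" "z \<in> ?D w" "z \<in> ?D 0" "w \<in> ?D' 0" for z w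
    using orthogonal_if_twice_epi_differentiable[OF that(1) sub that(2,3)] that(4)
    by (simp add: dual)
  show ?thesis
    using split tangents orth epi by blast
qed

end
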